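(* Consider the problem OWA $\mathcal{P}$: given $\mathcal{X}\subseteq\{0,1\}^n$, nonnegative cost vectors $\pmb{c}_1,\dots,\pmb{c}_K\in\mathbb{R}^n_{\ge0}$ and a weight vector $\pmb{w}$ with $w_k\in[0,1]$, $\sum_k w_k=1$ and $w_1\ge w_2\ge\dots\ge w_K$, minimize $\mathrm{OWA}_{\pmb{w}}(\pmb{c}_1^T\pmb{x},\dots,\pmb{c}_K^T\pmb{x})$ over $\pmb{x}\in\mathcal{X}$. Let $\ell\ge1$ be an integer with $K$ a multiple of $\ell$. The $\ell$-Aggregation Algorithm returns an optimal solution $\overline{\pmb{x}}$ of the instance of OWA $\mathcal{P}$ with the $K/\ell$ objectives $\overline{\pmb{c}}_k=\frac{1}{\ell}(\pmb{c}_{(k-1)\ell+1}+\dots+\pmb{c}_{k\ell})$, $k\in[K/\ell]$, and weights $\overline{w}_k=w_{(k-1)\ell+1}+\dots+w_{k\ell}$, $k\in[K/\ell]$. Then the $\ell$-Aggregation Algorithm has approximation ratio $\rho\ell$, i.e. $$\mathrm{OWA}_{\pmb{w}}(\pmb{c}_1^T\overline{\pmb{x}},\dots,\pmb{c}_K^T\overline{\pmb{x}})\le \rho\ell\cdot\min_{\pmb{x}\in\mathcal{X}}\mathrm{OWA}_{\pmb{w}}(\pmb{c}_1^T\pmb{x},\dots,\pmb{c}_K^T\pmb{x}),$$ where $\rho=\max_{k\in[K/\ell]}\frac{\sum_{i=1}^k w_i}{\sum_{i=1}^k\overline{w}_i}$.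
   Context: $[m]=\{1,\dots,m\}$. For a real vector $\pmb{b}=(b_1,\dots,b_m)$ and a weight vector $\pmb{v}=(v_1,\dots,v_m)$ (nonnegative, summing to 1), $\mathrm{OWA}_{\pmb{v}}(\pmb{b})=\sum_{k\in[m]}v_k b_{\tau(k)}$, where $\tau$ is a permutation of $[m]$ with $b_{\tau(1)}\ge\dots\ge b_{\tau(m)}$. *)

theory Defs
  imports "HOL-Analysis.Analysis" "HOL-Combinatorics.Permutations"
begin

definition owa_order :: "nat \<Rightarrow> (nat \<Rightarrow> real) \<Rightarrow> (nat \<Rightarrow> nat) \<Rightarrow> bool" where
  "owa_order m b \<tau> \<longleftrightarrow> \<tau> permutes {1..m} \<and> antimono_on {1..m} (\<lambda>k. b (\<tau> k))"

text \<open>The choice of the ordering permutation is immaterial, see \<open>owa_eqI\<close> below.\<close>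

definition OWA :: "nat \<Rightarrow> (nat \<Rightarrow> real) \<Rightarrow> (nat \<Rightarrow> real) \<Rightarrow> real" where
  "OWA m v b = (let \<tau> = (SOME \<tau>. owa_order m b \<tau>) in \<Sum>k=1..m. v k * b (\<tau> k))"

lemma owa_order_exists: "\<exists>\<tau>. owa_order m b \<tau>"
proof -
  define xs where "xs = sort_key (\<lambda>i. - b i) [1..<Suc m]"
  define \<tau> where "\<tau> k = (if k \<in> {1..m} then xs ! (k - 1) else k)" for k
  have len: "length xs = m" and set: "set xs = {1..m}" and dist: "distinct xs"
    by (auto simp: xs_def)
  have "bij_betw (\<lambda>i. xs ! i) {..<m} {1..m}"
    using bij_betw_nth[OF dist] len set by auto
  moreover have "bij_betw (\<lambda>k. k - 1) {1..m} {..<m}"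
    by (rule bij_betw_byWitness[where f' = Suc]) auto
  ultimately have "bij_betw ((\<lambda>i. xs ! i) \<circ> (\<lambda>k. k - 1)) {1..m} {1..m}"
    using bij_betw_trans by blast
  then have "bij_betw \<tau> {1..m} {1..m}"
    by (rule bij_betw_cong[THEN iffD1, rotated]) (auto simp: \<tau>_def)
  then have "\<tau> permutes {1..m}"
    by (rule bij_imp_permutes) (auto simp: \<tau>_def)
  moreover have "sorted (map (\<lambda>i. - b i) xs)"
    by (simp add: xs_def)
  then have "b (xs ! j) \<le> b (xs ! i)" if "i \<le> j" "j < m" for i j
    using that len by (auto simp: sorted_iff_nth_mono)
  then have "antimono_on {1..m} (\<lambda>k. b (\<tau> k))"
    by (auto simp: monotone_on_def \<tau>_def)
  ultimately show ?thesis
    unfolding owa_order_def by blast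
qed

lemma owa_order_unique:
  assumes "owa_order m b \<sigma>" "owa_order m b \<tau>" "k \<in> {1..m}"
  shows "b (\<sigma> k) = b (\<tau> k)"
proof -
  define L where "L \<rho> = map (\<lambda>i. - b (\<rho> i)) [1..<Suc m]" for \<rho> :: "nat \<Rightarrow> nat"
  have sorted: "sorted (L \<rho>)" if "owa_order m b \<rho>" for \<rho>
    using that unfolding L_def owa_order_def monotone_on_def
    by (auto simp: sorted_iff_nth_mono simp del: upt_Suc)
  have mset: "mset (L \<rho>) = image_mset (\<lambda>i. - b i) (mset_set {1..m})"
    if "owa_order m b \<rho>" for \<rho>
  proof -
    have "\<rho> permutes {1..m}" using that by (simp add: owa_order_def)
    then have "image_mset \<rho> (mset_set {1..m}) = mset_set {1..m}"
      by (simp add: image_mset_mset_set permutes_image permutes_inj_on)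
    moreover have "mset [1..<Suc m] = mset_set {1..m}"
      using mset_upt[of 1 "Suc m"] atLeastLessThanSuc_atLeastAtMost[of 1 m] by metis
    then have "mset (L \<rho>) = image_mset (\<lambda>i. - b i) (image_mset \<rho> (mset_set {1..m}))"
      unfolding L_def by (simp add: multiset.map_comp comp_def del: upt_Suc)
    ultimately show ?thesis by simp
  qed
  have "L \<sigma> = L \<tau>"
    using assms(1,2) sorted mset by (metis properties_for_sort)
  then show ?thesis
    using assms(3) by (auto simp: L_def simp del: upt_Suc)
qed

lemma owa_eqI:
  assumes "owa_order m b \<tau>"
  shows "OWA m v b = (\<Sum>k=1..m. v k * b (\<tau> k))"
proof -
  have "owa_order m b (SOME \<tau>. owa_order m b \<tau>)"
    using owa_order_exists by (rule someI_ex)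
  then show ?thesis
    unfolding OWA_def Let_def
    by (intro sum.cong refl) (simp add: owa_order_unique[OF _ assms])
qed

definition owa_cost :: "nat \<Rightarrow> (nat \<Rightarrow> real) \<Rightarrow> (nat \<Rightarrow> real ^ 'n) \<Rightarrow> real ^ 'n \<Rightarrow> real" where
  "owa_cost m v c x = OWA m v (\<lambda>k. c k \<bullet> x)"

definition owa_optimal ::
  "(real ^ 'n) set \<Rightarrow> nat \<Rightarrow> (nat \<Rightarrow> real) \<Rightarrow> (nat \<Rightarrow> real ^ 'n) \<Rightarrow> real ^ 'n \<Rightarrow> bool" where
  "owa_optimal X m v c x \<longleftrightarrow> is_arg_min (owa_cost m v c) (\<lambda>y. y \<in> X) x"

definition aggr_cost :: "nat \<Rightarrow> (nat \<Rightarrow> real ^ 'n) \<Rightarrow> nat \<Rightarrow> real ^ 'n" where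
  "aggr_cost l c k = (1 / real l) *\<^sub>R (\<Sum>j=(k - 1) * l + 1..k * l. c j)"

definition aggr_weight :: "nat \<Rightarrow> (nat \<Rightarrow> real) \<Rightarrow> nat \<Rightarrow> real" where
  "aggr_weight l w k = (\<Sum>j=(k - 1) * l + 1..k * l. w j)"

definition aggr_ratio :: "nat \<Rightarrow> nat \<Rightarrow> (nat \<Rightarrow> real) \<Rightarrow> real" where
  "aggr_ratio K l w =
     Max ((\<lambda>k. (\<Sum>i=1..k. w i) / (\<Sum>i=1..k. aggr_weight l w i)) ` {1..K div l})"

end

theory Submission
  imports Defs
begin

text \<open>
  Let \<open>b\<close> be a nonnegative vector of length \<open>M * l\<close> and \<open>a\<close> the vector of its \<open>M\<close> block averages.
  Replacing every entry of \<open>b\<close> by the average of its block is a doubly stochastic operation, which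
  lowers all sums of the \<open>j\<close> largest entries; as the weights decrease, the aggregated OWA value of
  \<open>a\<close> is at most the OWA value of \<open>b\<close>. Conversely, any \<open>j\<close> entries of \<open>b\<close> meet at most
  \<open>min j M\<close> blocks, so their sum is at most the sum of the \<open>min j M\<close> largest block sums
  \<open>l * a k\<close>; hence the OWA value of \<open>b\<close> is at most the sum of \<open>w k\<close> times the \<open>k\<close>-th largest
  block sum over \<open>k \<le> M\<close>, and summation by parts compares the weights \<open>w\<close> with the aggregated
  weights at the price of the factor \<open>\<rho>\<close>. Chaining both estimates through the optimality of the
  returned solution for the aggregated instance gives the ratio \<open>\<rho> * l\<close>.
\<close>

section \<open>Weighted sums and sums of largest entries\<close>

text \<open>Summation by parts: with \<open>D j\<close> the partial sums of \<open>g - f\<close>,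
  the difference of the two sides is \<open>w n * D n\<close> plus the terms
  \<open>(w k - w (k + 1)) * D k\<close> for \<open>k < n\<close>, all nonnegative.\<close>

lemma weighted_sum_mono_partial_sums:
  fixes w f g :: "nat \<Rightarrow> real"
  assumes anti: "antimono_on {1..n} w"
    and nonneg: "\<And>k. k \<in> {1..n} \<Longrightarrow> 0 \<le> w k"
    and le: "\<And>j. j \<in> {1..n} \<Longrightarrow> (\<Sum>k=1..j. f k) \<le> (\<Sum>k=1..j. g k)"
  shows "(\<Sum>k=1..n. w k * f k) \<le> (\<Sum>k=1..n. w k * g k)"
proof -
  define D where "D j = (\<Sum>k=1..j. g k - f k)" for j
  have D_nonneg: "0 \<le> D j" if "j \<in> {1..n}" for j
    using le[OF that] by (simp add: D_def sum_subtractf)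
  \<comment> \<open>The induction keeps only the boundary term of the summation by parts; the
    dropped terms are nonnegative.\<close>
  have "w m * D m \<le> (\<Sum>k=1..m. w k * (g k - f k))" if "1 \<le> m" "m \<le> n" for m
    using that
  proof (induction m rule: dec_induct)
    case base
    show ?case by (simp add: D_def)
  next
    case (step m)
    have "w (Suc m) \<le> w m"
      using anti step.hyps step.prems by (auto simp: monotone_on_def)
    moreover have "0 \<le> D m" using D_nonneg step.hyps step.prems by simp
    ultimately have "w (Suc m) * D m \<le> w m * D m" by (rule mult_right_mono)
    moreover have "D (Suc m) = D m + (g (Suc m) - f (Suc m))"
      by (simp add: D_def)
    ultimately show ?case
      using step by (simp add: distrib_left)
  qed
  then have "n = 0 \<or> w n * D n \<le> (\<Sum>k=1..n. w k * (g k - f k))"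
    by (cases "n = 0") auto
  moreover have "n = 0 \<or> 0 \<le> w n * D n"
    using nonneg D_nonneg by (cases "n = 0") auto
  ultimately have "0 \<le> (\<Sum>k=1..n. w k * (g k - f k))"
    by auto
  then show ?thesis
    by (simp add: right_diff_distrib sum_subtractf)
qed

text \<open>A fractional knapsack bound: a fractional choice of total mass at most \<open>j\<close>
  cannot beat taking the \<open>j\<close> largest entries. Fractions \<open>q i\<close> arise from
  averaging over blocks, 0/1 values from selecting whole blocks.\<close>

lemma fractional_sum_le_sum_largest:
  fixes b q :: "nat \<Rightarrow> real"
  assumes ord: "owa_order m b \<tau>"
    and b: "\<And>i. i \<in> {1..m} \<Longrightarrow> 0 \<le> b i"
    and q: "\<And>i. i \<in> {1..m} \<Longrightarrow> 0 \<le> q i \<and> q i \<le> 1"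
    and sum_q: "(\<Sum>i=1..m. q i) \<le> real j"
    and j: "1 \<le> j" "j \<le> m"
  shows "(\<Sum>i=1..m. q i * b i) \<le> (\<Sum>k=1..j. b (\<tau> k))"
proof -
  have perm: "\<tau> permutes {1..m}" and anti: "antimono_on {1..m} (\<lambda>k. b (\<tau> k))"
    using ord by (auto simp: owa_order_def)
  have in_range: "\<tau> i \<in> {1..m}" if "i \<in> {1..m}" for i
    using permutes_in_image[OF perm] that by blast
  \<comment> \<open>The \<open>j\<close>-th largest entry serves as the price of one unit of mass,
    that is, as the multiplier of the constraint on the sum of \<open>q\<close>.\<close>
  define s where "s = b (\<tau> j)"
  have s: "0 \<le> s" using b in_range j by (simp add: s_def)
  have split: "(\<Sum>i=1..m. if i \<le> j then h i else 0) = (\<Sum>i=1..j. h i)"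
    for h :: "nat \<Rightarrow> real"
    using j by (intro sum.mono_neutral_cong_right) auto
  have "(\<Sum>i=1..m. q i * b i) = (\<Sum>i=1..m. q (\<tau> i) * b (\<tau> i))"
    using sum.permute[OF perm, of "\<lambda>i. q i * b i"] by (simp add: comp_def)
  \<comment> \<open>Termwise, the surplus of the right side is
    \<open>(b (\<tau> i) - s) * (1 - q (\<tau> i))\<close> for \<open>i \<le> j\<close> and
    \<open>(s - b (\<tau> i)) * q (\<tau> i)\<close> beyond. The terms with factor \<open>s\<close>
    add up to something nonpositive.\<close>
  also have "\<dots> \<le> (\<Sum>i=1..m. (if i \<le> j then b (\<tau> i) else 0) +
      s * (q (\<tau> i) - (if i \<le> j then 1 else 0)))"
  proof (rule sum_mono)
    fix i assume i: "i \<in> {1..m}"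
    note qi = q[OF in_range[OF i]]
    show "q (\<tau> i) * b (\<tau> i) \<le> (if i \<le> j then b (\<tau> i) else 0) +
        s * (q (\<tau> i) - (if i \<le> j then 1 else 0))"
    proof (cases "i \<le> j")
      case True
      then have "s \<le> b (\<tau> i)"
        using anti i j by (auto simp: monotone_on_def s_def)
      then have "0 \<le> (b (\<tau> i) - s) * (1 - q (\<tau> i))"
        using qi by simp
      then show ?thesis using True by (simp add: algebra_simps)
    next
      case False
      then have "b (\<tau> i) \<le> s"
        using anti i j by (auto simp: monotone_on_def s_def)
      then show ?thesis
        using False qi by (simp add: mult.commute mult_right_mono)
    qed
  qed
  also have "\<dots> = (\<Sum>k=1..j. b (\<tau> k)) + s * ((\<Sum>i=1..m. q (\<tau> i)) - real j)"
    unfolding sum.distrib sum_subtractf sum_distrib_left[symmetric] split by simp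
  also have "(\<Sum>i=1..m. q (\<tau> i)) = (\<Sum>i=1..m. q i)"
    using sum.permute[OF perm, of q] by (simp add: comp_def)
  also have "(\<Sum>k=1..j. b (\<tau> k)) + s * ((\<Sum>i=1..m. q i) - real j) \<le> (\<Sum>k=1..j. b (\<tau> k))"
    using s sum_q by (simp add: mult_nonneg_nonpos)
  finally show ?thesis .
qed

section \<open>Blocks of consecutive indices\<close>

definition block :: "nat \<Rightarrow> nat \<Rightarrow> nat set" where
  "block l k = {(k - 1) * l + 1..k * l}"

text \<open>Indices and blocks are both counted from 1, hence the shift before and after the
  division.\<close>

definition block_index :: "nat \<Rightarrow> nat \<Rightarrow> nat" where
  "block_index l j = (j - 1) div l + 1"

definition block_average :: "nat \<Rightarrow> (nat \<Rightarrow> real) \<Rightarrow> nat \<Rightarrow> real" where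
  "block_average l b k = (\<Sum>j\<in>block l k. b j) / real l"

lemma finite_block [simp]: "finite (block l k)"
  by (simp add: block_def)

lemma card_block: "1 \<le> k \<Longrightarrow> card (block l k) = l"
  by (cases k) (auto simp: block_def)

lemma block_index_eq:
  assumes "1 \<le> k" "j \<in> block l k"
  shows "block_index l j = k"
proof -
  obtain k' where k': "k = Suc k'" using assms(1) by (cases k) auto
  have j: "k' * l + 1 \<le> j" "j \<le> l + k' * l"
    using assms(2) by (auto simp: block_def k')
  then have "(j - 1) div l = k'"
    by (intro div_nat_eqI) (auto simp: mult.commute)
  then show ?thesis by (simp add: block_index_def k')
qed

lemma sum_blocks: "(\<Sum>j=1..M * l. f j) = (\<Sum>k=1..M. \<Sum>j\<in>block l k. f j)"
  for f :: "nat \<Rightarrow> real"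
proof (induction M)
  case (Suc M)
  have "{1..Suc M * l} = {1..M * l} \<union> block l (Suc M)"
    by (auto simp: block_def)
  moreover have "{1..M * l} \<inter> block l (Suc M) = {}"
    by (auto simp: block_def)
  ultimately have "(\<Sum>j=1..Suc M * l. f j) = (\<Sum>j=1..M * l. f j) + (\<Sum>j\<in>block l (Suc M). f j)"
    by (simp add: sum.union_disjoint)
  then show ?case using Suc by simp
qed simp

lemma block_subset: "k \<in> {1..M} \<Longrightarrow> block l k \<subseteq> {1..M * l}"
  using mult_le_mono1[of k M l] by (auto simp: block_def)

lemma block_index_range: "j \<in> {1..M * l} \<Longrightarrow> block_index l j \<in> {1..M}"
  by (auto simp: block_index_def Suc_le_eq less_mult_imp_div_less)

text \<open>Blocks are the fibres of \<open>block_index\<close>, so a sum restricted by a condition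
  on \<open>block_index\<close> becomes a sum over a block.\<close>

lemma block_eq_vimage:
  assumes "k \<in> {1..M}"
  shows "block l k = {j \<in> {1..M * l}. block_index l j = k}"
proof
  show "block l k \<subseteq> {j \<in> {1..M * l}. block_index l j = k}"
    using assms block_subset[OF assms, of l] block_index_eq[of k _ l] by auto
  show "{j \<in> {1..M * l}. block_index l j = k} \<subseteq> block l k"
  proof safe
    fix j assume j: "j \<in> {1..M * l}" and k: "k = block_index l j"
    have "0 < l" using j by (cases l) auto
    have "(j - 1) div l * l + (j - 1) mod l = j - 1" by simp
    moreover have "(j - 1) mod l < l" using \<open>0 < l\<close> by simp
    moreover have "j = Suc (j - 1)" using j by simp
    moreover have "((j - 1) div l + 1) * l = (j - 1) div l * l + l" by simp
    ultimately show "j \<in> block l (block_index l j)"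
      unfolding block_def block_index_def atLeastAtMost_iff add_diff_cancel_right' by linarith
  qed
qed

section \<open>The aggregated value as a lower bound\<close>

text \<open>Splitting each aggregated weight into its \<open>l\<close> summands gives a
  \<open>w\<close>-weighted sum of length \<open>M * l\<close>, in which each sorted average is
  repeated \<open>l\<close> times. Its prefix sums are then compared with those of the sorted
  \<open>b\<close>.\<close>

lemma aggregated_OWA_le_OWA:
  assumes l: "1 \<le> l"
    and b: "\<And>i. i \<in> {1..M * l} \<Longrightarrow> 0 \<le> b i"
    and anti: "antimono_on {1..M * l} w"
    and w: "\<And>k. k \<in> {1..M * l} \<Longrightarrow> 0 \<le> w k"
  shows "OWA M (aggr_weight l w) (block_average l b) \<le> OWA (M * l) w b"
proof -
  obtain \<sigma> where \<sigma>: "owa_order M (block_average l b) \<sigma>" using owa_order_exists by blast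
  obtain \<tau> where \<tau>: "owa_order (M * l) b \<tau>" using owa_order_exists by blast
  have perm: "\<sigma> permutes {1..M}" using \<sigma> by (simp add: owa_order_def)
  let ?g = "block_index l"
  have "OWA M (aggr_weight l w) (block_average l b)
      = (\<Sum>k=1..M. \<Sum>j\<in>block l k. w j * block_average l b (\<sigma> k))"
    by (simp add: owa_eqI[OF \<sigma>] aggr_weight_def sum_distrib_right block_def)
  also have "\<dots> = (\<Sum>k=1..M. \<Sum>j\<in>block l k. w j * block_average l b (\<sigma> (?g j)))"
    by (intro sum.cong refl) (auto simp: block_index_eq)
  also have "\<dots> = (\<Sum>j=1..M * l. w j * block_average l b (\<sigma> (?g j)))"
    by (rule sum_blocks[symmetric])
  also have "\<dots> \<le> (\<Sum>j=1..M * l. w j * b (\<tau> j))"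
  proof (rule weighted_sum_mono_partial_sums[OF anti w])
    fix j assume j: "j \<in> {1..M * l}"
    \<comment> \<open>\<open>P\<close> is the doubly stochastic matrix that averages over blocks and
      orders them by \<sigma>; \<open>q\<close> collects the column sums of its first
      \<open>j\<close> rows.\<close>
    define P where "P k i = (if \<sigma> (?g k) = ?g i then 1 / real l else 0)" for k i
    define q where "q i = (\<Sum>k=1..j. P k i)" for i
    have P_nonneg: "0 \<le> P k i" for k i by (simp add: P_def)
    have \<sigma>_range: "\<sigma> (?g k) \<in> {1..M}" if "k \<in> {1..M * l}" for k
      using permutes_in_image[OF perm] block_index_range[OF that] by blast
    have row: "(\<Sum>i=1..M * l. P k i * f i) = (\<Sum>i\<in>block l (\<sigma> (?g k)). f i) / real l"
      if "k \<in> {1..M * l}" for k and f :: "nat \<Rightarrow> real"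
    proof -
      have "(\<Sum>i\<in>block l (\<sigma> (?g k)). f i) / real l = (\<Sum>i\<in>block l (\<sigma> (?g k)). P k i * f i)"
        using \<sigma>_range[OF that]
        by (auto simp: sum_divide_distrib P_def block_index_eq intro!: sum.cong)
      also have "\<dots> = (\<Sum>i=1..M * l. P k i * f i)"
        unfolding block_eq_vimage[OF \<sigma>_range[OF that], of l]
        by (rule sum.mono_neutral_left) (auto simp: P_def)
      finally show ?thesis by simp
    qed
    have "(\<Sum>k=1..j. block_average l b (\<sigma> (?g k))) = (\<Sum>k=1..j. \<Sum>i=1..M * l. P k i * b i)"
      using j row[of _ b] by (intro sum.cong refl) (simp add: block_average_def)
    also have "\<dots> = (\<Sum>i=1..M * l. q i * b i)"
      unfolding q_def sum_distrib_right by (rule sum.swap)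
    also have "\<dots> \<le> (\<Sum>k=1..j. b (\<tau> k))"
    proof (rule fractional_sum_le_sum_largest[OF \<tau> b])
      fix i assume i: "i \<in> {1..M * l}"
      \<comment> \<open>\<open>m\<close> is the position of the block of \<open>i\<close> in the
        sorted order. Column \<open>i\<close> of \<open>P\<close> is supported on the rows in
        \<open>block l m\<close>, so its full sum is 1.\<close>
      define m where "m = inv \<sigma> (?g i)"
      have m: "m \<in> {1..M}"
        using permutes_in_image[OF permutes_inv[OF perm]] block_index_range[OF i]
        by (simp add: m_def)
      have P_eq: "P k i = (if ?g k = m then 1 / real l else 0)" for k
        unfolding P_def m_def using permutes_inverses[OF perm] by metis
      have "q i \<le> (\<Sum>k=1..M * l. P k i)"
        unfolding q_def using j P_nonneg by (intro sum_mono2) auto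
      also have "\<dots> = (\<Sum>k\<in>block l m. 1 / real l)"
        unfolding block_eq_vimage[OF m] by (intro sum.mono_neutral_cong_right) (auto simp: P_eq)
      also have "\<dots> = 1"
        using l m by (simp add: card_block)
      finally show "0 \<le> q i \<and> q i \<le> 1"
        using P_nonneg by (simp add: q_def sum_nonneg)
    next
      have "(\<Sum>i=1..M * l. q i) = (\<Sum>k=1..j. \<Sum>i=1..M * l. P k i * 1)"
        unfolding q_def mult_1_right by (rule sum.swap)
      also have "\<dots> = (\<Sum>k=1..j. 1)"
      proof (intro sum.cong refl)
        fix k assume "k \<in> {1..j}"
        then have k: "k \<in> {1..M * l}" using j by auto
        show "(\<Sum>i=1..M * l. P k i * 1) = 1"
          using \<sigma>_range[OF k] l unfolding row[OF k] by (simp add: card_block)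
      qed
      finally show "(\<Sum>i=1..M * l. q i) \<le> real j" by simp
    qed (use j in auto)
    finally show "(\<Sum>k=1..j. block_average l b (\<sigma> (?g k))) \<le> (\<Sum>k=1..j. b (\<tau> k))" .
  qed
  also have "\<dots> = OWA (M * l) w b" by (simp add: owa_eqI[OF \<tau>])
  finally show ?thesis .
qed

section \<open>Upper bounds by block averages\<close>

text \<open>This is where the factor \<open>l\<close> enters: block sums, not averages, dominate the
  entries of \<open>b\<close>. The weights are not aggregated yet.\<close>

lemma OWA_le_sum_largest_block_averages:
  assumes l: "1 \<le> l"
    and b: "\<And>i. i \<in> {1..M * l} \<Longrightarrow> 0 \<le> b i"
    and anti: "antimono_on {1..M * l} w"
    and w: "\<And>k. k \<in> {1..M * l} \<Longrightarrow> 0 \<le> w k"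
    and \<sigma>: "owa_order M (block_average l b) \<sigma>"
  shows "OWA (M * l) w b \<le> real l * (\<Sum>k=1..M. w k * block_average l b (\<sigma> k))"
proof -
  obtain \<tau> where \<tau>: "owa_order (M * l) b \<tau>" using owa_order_exists by blast
  have perm: "\<tau> permutes {1..M * l}" using \<tau> by (simp add: owa_order_def)
  have perm': "\<sigma> permutes {1..M}" using \<sigma> by (simp add: owa_order_def)
  let ?a = "block_average l b"
  \<comment> \<open>The sorted block sums, padded with zeros to length \<open>M * l\<close>.\<close>
  let ?u = "\<lambda>k. if k \<le> M then real l * ?a (\<sigma> k) else 0"
  have a_nonneg: "0 \<le> ?a k" if "k \<in> {1..M}" for k
    using b block_subset[OF that, of l]
    by (auto simp: block_average_def intro!: sum_nonneg divide_nonneg_nonneg)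
  have block_sum: "(\<Sum>i\<in>block l k. b i) = real l * ?a k" for k
    using l by (simp add: block_average_def)
  have "M \<le> M * l" using l by simp
  have "OWA (M * l) w b = (\<Sum>k=1..M * l. w k * b (\<tau> k))" by (rule owa_eqI[OF \<tau>])
  also have "\<dots> \<le> (\<Sum>k=1..M * l. w k * ?u k)"
  proof (rule weighted_sum_mono_partial_sums[OF anti w])
    fix j assume j: "j \<in> {1..M * l}"
    define S where "S = \<tau> ` {1..j}"
    define T where "T = block_index l ` S"
    have S: "S \<subseteq> {1..M * l}"
      using j permutes_in_image[OF perm] by (fastforce simp: S_def)
    have inj: "inj_on \<tau> {1..j}" using perm permutes_inj_on by blast
    have T: "T \<subseteq> {1..M}"
      using S block_index_range unfolding T_def by blast
    have "finite S" by (simp add: S_def)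
    have "card T \<le> card S" unfolding T_def using \<open>finite S\<close> by (rule card_image_le)
    also have "card S = j" unfolding S_def using inj by (simp add: card_image)
    finally have card_T: "card T \<le> j" .
    have "(\<Sum>k=1..j. b (\<tau> k)) = (\<Sum>i\<in>S. b i)"
      unfolding S_def using inj by (simp add: sum.reindex)
    \<comment> \<open>By nonnegativity, every block that meets \<open>S\<close> may be filled up
      completely.\<close>
    also have "\<dots> \<le> (\<Sum>i\<in>{i \<in> {1..M * l}. block_index l i \<in> T}. b i)"
      using S b by (intro sum_mono2) (auto simp: T_def)
    also have "\<dots> = (\<Sum>i=1..M * l. if block_index l i \<in> T then b i else 0)"
      by (rule sum.inter_filter) simp
    also have "\<dots> = (\<Sum>k=1..M. \<Sum>i\<in>block l k. if k \<in> T then b i else 0)"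
      unfolding sum_blocks by (intro sum.cong refl) (auto simp: block_index_eq)
    also have "\<dots> = (\<Sum>k=1..M. of_bool (k \<in> T) * (real l * ?a k))"
      by (intro sum.cong refl) (simp add: block_sum)
    also have "\<dots> \<le> (\<Sum>k=1..j. ?u k)"
    \<comment> \<open>For \<open>j \<le> M\<close> the at most \<open>j\<close> blocks in
      \<open>T\<close> are compared with the \<open>j\<close> largest; for larger \<open>j\<close>
      the right side already contains all block sums.\<close>
    proof (cases "j \<le> M")
      case True
      have "(\<Sum>k=1..M. of_bool (k \<in> T) * ?a k) \<le> (\<Sum>k=1..j. ?a (\<sigma> k))"
      proof (rule fractional_sum_le_sum_largest[OF \<sigma> a_nonneg])
        have "(\<Sum>k=1..M. of_bool (k \<in> T)) = real (card T)"
          using T by (simp add: Int_absorb1 Int_def[symmetric])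
        then show "(\<Sum>k=1..M. of_bool (k \<in> T)) \<le> real j"
          using card_T by simp
      qed (use True j in auto)
      then have "real l * (\<Sum>k=1..M. of_bool (k \<in> T) * ?a k) \<le> real l * (\<Sum>k=1..j. ?a (\<sigma> k))"
        by (simp add: mult_left_mono)
      also have "\<dots> = (\<Sum>k=1..j. ?u k)"
        using True by (simp add: sum_distrib_left)
      finally show ?thesis unfolding sum_distrib_left by (simp only: mult.left_commute)
    next
      case False
      have "(\<Sum>k=1..M. of_bool (k \<in> T) * (real l * ?a k)) \<le> (\<Sum>k=1..M. real l * ?a k)"
        using a_nonneg by (intro sum_mono) auto
      also have "\<dots> = (\<Sum>k=1..M. real l * ?a (\<sigma> k))"
        using sum.permute[OF perm', of "\<lambda>k. real l * ?a k"] by (simp add: comp_def)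
      also have "\<dots> = (\<Sum>k=1..j. ?u k)"
        using False by (intro sum.mono_neutral_cong_left) auto
      finally show ?thesis .
    qed
    finally show "(\<Sum>k=1..j. b (\<tau> k)) \<le> (\<Sum>k=1..j. ?u k)" .
  qed
  also have "\<dots> = (\<Sum>k=1..M. w k * (real l * ?a (\<sigma> k)))"
    using \<open>M \<le> M * l\<close> by (intro sum.mono_neutral_cong_right) auto
  finally show ?thesis by (simp add: sum_distrib_left algebra_simps)
qed

lemma aggr_weight_partial_sum: "(\<Sum>i=1..k. aggr_weight l w i) = (\<Sum>j=1..k * l. w j)"
  unfolding sum_blocks aggr_weight_def block_def ..

text \<open>Each denominator in the ratio is the sum of the first \<open>k * l\<close> weights,
  hence at least \<open>w 1 > 0\<close>, and the quotient can be multiplied out.\<close>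

lemma partial_sum_le_aggr_ratio:
  assumes l: "1 \<le> l"
    and w: "\<And>k. k \<in> {1..M * l} \<Longrightarrow> 0 \<le> w k"
    and pos: "0 < w 1"
    and k: "k \<in> {1..M}"
  shows "(\<Sum>i=1..k. w i) \<le> aggr_ratio (M * l) l w * (\<Sum>i=1..k. aggr_weight l w i)"
    and "0 \<le> aggr_ratio (M * l) l w"
proof -
  let ?A = "\<Sum>i=1..k. aggr_weight l w i"
  have ratio: "(\<Sum>i=1..k. w i) / ?A \<le> aggr_ratio (M * l) l w"
    unfolding aggr_ratio_def using k l by (intro Max_ge) auto
  have le: "k \<le> M * l" "k * l \<le> M * l" "1 \<le> k * l"
    using k l by (auto intro: order_trans[of k M])
  have "0 \<le> w j" if "j \<in> {1..k * l}" for j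
    using that order_trans[OF _ le(2)] by (intro w) auto
  then have "w 1 \<le> (\<Sum>j=1..k * l. w j)"
    using le(3) by (intro member_le_sum) auto
  then have "0 < ?A" using pos unfolding aggr_weight_partial_sum by linarith
  then show "(\<Sum>i=1..k. w i) \<le> aggr_ratio (M * l) l w * ?A"
    using ratio by (simp add: pos_divide_le_eq)
  have "0 \<le> (\<Sum>i=1..k. w i)" using w le by (intro sum_nonneg) auto
  then have "0 \<le> (\<Sum>i=1..k. w i) / ?A" using \<open>0 < ?A\<close> by simp
  then show "0 \<le> aggr_ratio (M * l) l w" using ratio by linarith
qed

text \<open>Summation by parts with the roles exchanged: the sorted averages act as the decreasing
  weights, while the prefix sums of \<open>w\<close> and of the scaled aggregated weights are
  compared.\<close>

lemma OWA_le_aggregated_OWA: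
  assumes l: "1 \<le> l"
    and b: "\<And>i. i \<in> {1..M * l} \<Longrightarrow> 0 \<le> b i"
    and anti: "antimono_on {1..M * l} w"
    and w: "\<And>k. k \<in> {1..M * l} \<Longrightarrow> 0 \<le> w k"
    and pos: "0 < w 1"
  shows "OWA (M * l) w b
    \<le> aggr_ratio (M * l) l w * real l * OWA M (aggr_weight l w) (block_average l b)"
proof -
  obtain \<sigma> where \<sigma>: "owa_order M (block_average l b) \<sigma>" using owa_order_exists by blast
  let ?a = "\<lambda>k. block_average l b (\<sigma> k)"
  let ?\<rho> = "aggr_ratio (M * l) l w"
  have a_nonneg: "0 \<le> ?a k" if "k \<in> {1..M}" for k
  proof -
    have "\<sigma> k \<in> {1..M}"
      using \<sigma> that permutes_in_image[of \<sigma> "{1..M}" k] by (simp add: owa_order_def)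
    then show ?thesis
      using b block_subset[of "\<sigma> k" M l]
      by (auto simp: block_average_def intro!: sum_nonneg divide_nonneg_nonneg)
  qed
  have "antimono_on {1..M} ?a" using \<sigma> by (simp add: owa_order_def)
  then have "(\<Sum>k=1..M. ?a k * w k) \<le> (\<Sum>k=1..M. ?a k * (?\<rho> * aggr_weight l w k))"
  proof (rule weighted_sum_mono_partial_sums[OF _ a_nonneg])
    fix j assume "j \<in> {1..M}"
    then show "(\<Sum>k=1..j. w k) \<le> (\<Sum>k=1..j. ?\<rho> * aggr_weight l w k)"
      unfolding sum_distrib_left[symmetric]
      by (intro partial_sum_le_aggr_ratio(1) l w pos)
  qed
  also have "\<dots> = ?\<rho> * OWA M (aggr_weight l w) (block_average l b)"
    by (simp add: owa_eqI[OF \<sigma>] sum_distrib_left algebra_simps)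
  finally have "real l * (\<Sum>k=1..M. w k * ?a k)
      \<le> real l * (?\<rho> * OWA M (aggr_weight l w) (block_average l b))"
    by (simp add: mult.commute mult_left_mono)
  with OWA_le_sum_largest_block_averages[OF l b anti w \<sigma>] show ?thesis
    by (simp add: algebra_simps)
qed

section \<open>Application to the optimization problem\<close>

lemma owa_cost_aggr_cost:
  "owa_cost M v (aggr_cost l c) x = OWA M v (block_average l (\<lambda>k. c k \<bullet> x))"
  by (simp add: owa_cost_def aggr_cost_def block_average_def[abs_def] block_def inner_sum_left)

text \<open>Makes the feasible set finite, so that \<open>Min\<close> in the theorem is attained by
  some solution.\<close>

lemma finite_binary_vectors: "finite {x :: real ^ 'n. \<forall>i. x $ i \<in> {0, 1}}"
proof (rule finite_imageD)
  have "vec_nth ` {x :: real ^ 'n. \<forall>i. x $ i \<in> {0, 1}} \<subseteq> PiE UNIV (\<lambda>_. {0, 1})"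
    by auto
  then show "finite (vec_nth ` {x :: real ^ 'n. \<forall>i. x $ i \<in> {0, 1}})"
    by (rule finite_subset) (intro finite_PiE, auto)
  show "inj_on vec_nth {x :: real ^ 'n. \<forall>i. x $ i \<in> {0, 1}}"
    by (auto simp: inj_on_def vec_nth_inject)
qed

theorem theorem1:
  fixes X :: "(real ^ 'n) set"
    and c :: "nat \<Rightarrow> real ^ 'n"
    and w :: "nat \<Rightarrow> real"
    and K l :: nat
    and xbar :: "real ^ 'n"
  assumes "X \<subseteq> {x. \<forall>i. x $ i \<in> {0, 1}}"
    and "\<forall>k\<in>{1..K}. \<forall>i. 0 \<le> c k $ i"
    and "\<forall>k\<in>{1..K}. w k \<in> {0..1}"
    and "(\<Sum>k=1..K. w k) = 1"
    and "antimono_on {1..K} w"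
    and "1 \<le> l"
    and "l dvd K"
    and "owa_optimal X (K div l) (aggr_weight l w) (aggr_cost l c) xbar"
  shows "owa_cost K w c xbar
           \<le> aggr_ratio K l w * real l * Min (owa_cost K w c ` X)"
proof -
  define M where "M = K div l"
  have K: "K = M * l" using assms(7) by (simp add: M_def)
  have "K \<noteq> 0" using assms(4) by (cases K) auto
  then have "1 \<in> {1..M}" using K by (cases M) auto
  have w: "0 \<le> w k" if "k \<in> {1..M * l}" for k using assms(3) that K by auto
  have anti: "antimono_on {1..M * l} w" using assms(5) K by simp
  have pos: "0 < w 1"
  proof (rule ccontr)
    assume "\<not> 0 < w 1"
    then have "w k \<le> 0" if "k \<in> {1..K}" for k
      using assms(5) that by (auto simp: monotone_on_def intro: order_trans[of _ "w 1"])
    then have "(\<Sum>k=1..K. w k) \<le> 0" by (rule sum_nonpos)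
    then show False using assms(4) by simp
  qed
  have c: "0 \<le> c k \<bullet> x" if "x \<in> X" "k \<in> {1..M * l}" for x k
    unfolding inner_vec_def
  proof (rule sum_nonneg)
    fix i
    have "x $ i \<in> {0, 1}" using assms(1) that(1) by blast
    moreover have "0 \<le> c k $ i" using assms(2) that(2) K by blast
    ultimately show "0 \<le> c k $ i \<bullet> x $ i" by auto
  qed
  let ?agg = "owa_cost M (aggr_weight l w) (aggr_cost l c)"
  have opt: "?agg xbar \<le> ?agg x" if "x \<in> X" for x
    using assms(8) that by (auto simp: owa_optimal_def is_arg_min_linorder M_def)
  have "xbar \<in> X" using assms(8) by (simp add: owa_optimal_def is_arg_min_def)
  have "finite X" using assms(1) finite_binary_vectors by (rule finite_subset)
  then have "Min (owa_cost K w c ` X) \<in> owa_cost K w c ` X"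
    using \<open>xbar \<in> X\<close> by (intro Min_in) auto
  then obtain x where x: "x \<in> X" "Min (owa_cost K w c ` X) = owa_cost K w c x" by auto
  have "owa_cost K w c xbar \<le> aggr_ratio K l w * real l * ?agg xbar"
    unfolding owa_cost_aggr_cost unfolding owa_cost_def K
    using c[OF \<open>xbar \<in> X\<close>] by (intro OWA_le_aggregated_OWA assms(6) anti w pos)
  also have "\<dots> \<le> aggr_ratio K l w * real l * owa_cost K w c x"
  proof (rule mult_left_mono)
    have "?agg x \<le> owa_cost K w c x"
      unfolding owa_cost_aggr_cost unfolding owa_cost_def K
      using c[OF x(1)] by (intro aggregated_OWA_le_OWA assms(6) anti w)
    then show "?agg xbar \<le> owa_cost K w c x" using opt[OF x(1)] by linarith
    \<comment> \<open>The sign of the ratio is read off from its entry for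
      \<open>k = 1\<close>.\<close>
    show "0 \<le> aggr_ratio K l w * real l"
      using partial_sum_le_aggr_ratio(2)[of l M w 1] assms(6) w pos \<open>1 \<in> {1..M}\<close> K by simp
  qed
  finally show ?thesis using x(2) by simp
qed

end
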